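(* Let $n\ge 1$ and let $(A,B)$ be an $n$-admissible pair of complex-valued random variables, with associated $\kappa_n\in\mathbb{N}$, $\mathcal{I}_n\subseteq\{1,\dots,\kappa_n\}$, independent random variables $D_1,\dots,D_{\kappa_n}$, and polynomials $p_n^{[i]}(z)=\mathbb{E}[(z-D_i)^n]$, $i=1,\dots,\kappa_n$. Assume that (i) for each $i=1,\dots,\kappa_n$, all roots of $p_n^{[i]}$ are real and nonnegative; (ii) $|\mathbb{E}[A^m]|=\prod_{i\in\mathcal{I}_n}\left|\widetilde{\mathsf e}_m^{(n)}(p_n^{[i]})\right|<1$ for all $m=1,\dots,n$. Then the finite free perpetuity polynomial $p_X$ of order $n$ generated by $(A,B)$ has only real, nonnegative roots.
   Context: Coefficients: every complex polynomial $p$ of degree at most $n$ is written uniquely as $p(z)=\sum_{k=0}^n(-1)^k\binom nk\widetilde{\mathsf e}_k^{(n)}(p)z^{n-k}$. $n$-distribution: for random vectors $\underline X,\underline Y\in\mathbb{C}^k$ with finite moments up to order $n$, $\underline X\stackrel{d}{=}_n\underline Y$ means $\mathbb{E}[\prod_{j=1}^k X_j^{i_j}]=\mathbb{E}[\prod_{j=1}^k Y_j^{i_j}]$ for all integers $i_1,\dots,i_k\ge 0$ with $\sum_j i_j\le n$. Affine maps: for $\kappa\in\mathbb{N}$, $\mathcal{I}\subseteq\{1,\dots,\kappa\}$ and $d_0,\dots,d_\kappa\in\mathbb{C}$ let $G_{\mathcal{I},\kappa}(d_0,d_1,\dots,d_\kappa):=(g_\kappa\circ g_{\kappa-1}\circ\cdots\circ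 g_1)(d_0)$, where $g_i(z)=d_iz$ if $i\in\mathcal{I}$ and $g_i(z)=z+d_i$ if $i\notin\mathcal{I}$. A pair $(A,B)$ of complex random variables is $n$-admissible if there exist $\kappa_n\in\mathbb{N}$, $\mathcal{I}_n\subseteq\{1,\dots,\kappa_n\}$ and independent complex random variables $D_1,\dots,D_{\kappa_n}$ with $\mathbb{E}[|D_i|^n]<\infty$ such that $(A,B)\stackrel{d}{=}_n\left(\prod_{i\in\mathcal{I}_n}D_i,\;G_{\mathcal{I}_n,\kappa_n}(0,D_1,\dots,D_{\kappa_n})\right)$. A random variable $X$ and a pair $(A,B)$ are affinely $n$-independent if $\mathbb{E}[X^iA^iB^j]=\mathbb{E}[X^i]\mathbb{E}[A^iB^j]$ for all $i,j\ge 0$, $i+j\le n$. A finite free perpetuity polynomial of order $n$ generated by $(A,B)$ is a polynomial $p_X(z)=\mathbb{E}[(z-X)^n]$, where $X$ is a complex random variable with finite moments up to order $n$ such that $X\stackrel{d}{=}_nAX+B$ and $X$ and $(A,B)$ are affinely $n$-independent. (When $\mathbb{E}[A^k]\ne1$ for $k=1,\dots,n$, this polynomial exists and is unique.) *)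

theory Defs
  imports "HOL-Probability.Probability" "HOL-Computational_Algebra.Polynomial"
begin

text \<open>A random vector in \<open>\<complex>\<^sup>k\<close> is a list of \<open>k\<close> complex random variables on one probability
  space; the exponents of a monomial are given by \<open>i 0, \<dots>, i (k - 1)\<close>.\<close>

definition monomial_rv :: "('a \<Rightarrow> complex) list \<Rightarrow> (nat \<Rightarrow> nat) \<Rightarrow> 'a \<Rightarrow> complex" where
  "monomial_rv Xs i \<omega> = (\<Prod>j<length Xs. (Xs ! j) \<omega> ^ i j)"

definition finite_moments :: "nat \<Rightarrow> 'a measure \<Rightarrow> ('a \<Rightarrow> complex) list \<Rightarrow> bool" where
  "finite_moments n M Xs \<longleftrightarrow>
     (\<forall>X\<in>set Xs. X \<in> borel_measurable M) \<and>
     (\<forall>i. (\<Sum>j<length Xs. i j) \<le> n \<longrightarrow> integrable M (monomial_rv Xs i))"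

definition eq_dist ::
    "nat \<Rightarrow> 'a measure \<Rightarrow> ('a \<Rightarrow> complex) list \<Rightarrow> 'b measure \<Rightarrow> ('b \<Rightarrow> complex) list \<Rightarrow> bool" where
  "eq_dist n M Xs N Ys \<longleftrightarrow>
     length Xs = length Ys \<and> finite_moments n M Xs \<and> finite_moments n N Ys \<and>
     (\<forall>i. (\<Sum>j<length Xs. i j) \<le> n \<longrightarrow>
        (\<integral>\<omega>. monomial_rv Xs i \<omega> \<partial>M) = (\<integral>\<omega>. monomial_rv Ys i \<omega> \<partial>N))"

primrec affine_comp :: "nat set \<Rightarrow> nat \<Rightarrow> (nat \<Rightarrow> complex) \<Rightarrow> complex" where
  "affine_comp I 0 d = d 0"
| "affine_comp I (Suc k) d =
     (if Suc k \<in> I then d (Suc k) * affine_comp I k d else affine_comp I k d + d (Suc k))"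

text \<open>Admissibility of \<open>(A, B)\<close>, witnessed by \<open>\<kappa>\<close>, \<open>I\<close> and \<open>D 1, \<dots>, D \<kappa>\<close>. The variables
  \<open>D i\<close> may live on another probability space than \<open>(A, B)\<close>. The value \<open>D 0\<close> is irrelevant:
  it is overwritten by the starting point \<open>0\<close>.\<close>

definition admissible_via ::
    "nat \<Rightarrow> 'a measure \<Rightarrow> ('a \<Rightarrow> complex) \<Rightarrow> ('a \<Rightarrow> complex) \<Rightarrow>
     nat \<Rightarrow> nat set \<Rightarrow> 'b measure \<Rightarrow> (nat \<Rightarrow> 'b \<Rightarrow> complex) \<Rightarrow> bool" where
  "admissible_via n M A B \<kappa> I N D \<longleftrightarrow>
     I \<subseteq> {1..\<kappa>} \<and>
     prob_space.indep_vars N (\<lambda>_. borel) D {1..\<kappa>} \<and>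
     (\<forall>i\<in>{1..\<kappa>}. integrable N (\<lambda>\<omega>. cmod (D i \<omega>) ^ n)) \<and>
     eq_dist n M [A, B] N
       [\<lambda>\<omega>. \<Prod>i\<in>I. D i \<omega>, \<lambda>\<omega>. affine_comp I \<kappa> ((\<lambda>i. D i \<omega>)(0 := 0))]"

text \<open>The integrability clause says that the expectation on the left-hand side exists; without
  it, the Bochner integral of a non-integrable function would be \<open>0\<close>.\<close>

definition affinely_independent ::
    "nat \<Rightarrow> 'a measure \<Rightarrow> ('a \<Rightarrow> complex) \<Rightarrow> ('a \<Rightarrow> complex) \<Rightarrow> ('a \<Rightarrow> complex) \<Rightarrow> bool" where
  "affinely_independent n M X A B \<longleftrightarrow>
     (\<forall>i j. i + j \<le> n \<longrightarrow>
        integrable M (\<lambda>\<omega>. X \<omega> ^ i * A \<omega> ^ i * B \<omega> ^ j) \<and>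
        (\<integral>\<omega>. X \<omega> ^ i * A \<omega> ^ i * B \<omega> ^ j \<partial>M) =
          (\<integral>\<omega>. X \<omega> ^ i \<partial>M) * (\<integral>\<omega>. A \<omega> ^ i * B \<omega> ^ j \<partial>M))"

definition expected_poly :: "nat \<Rightarrow> 'a measure \<Rightarrow> ('a \<Rightarrow> complex) \<Rightarrow> complex poly" where
  "expected_poly n M X = (THE p. \<forall>z. poly p z = (\<integral>\<omega>. (z - X \<omega>) ^ n \<partial>M))"

lemma poly_expected_poly:
  assumes "\<And>k. k \<le> n \<Longrightarrow> integrable M (\<lambda>\<omega>. X \<omega> ^ k)"
  shows "poly (expected_poly n M X) z = (\<integral>\<omega>. (z - X \<omega>) ^ n \<partial>M)"
proof -
  define q where
    "q = (\<Sum>k\<le>n. monom (of_nat (n choose k) * (-1) ^ k * (\<integral>\<omega>. X \<omega> ^ k \<partial>M)) (n - k))"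
  have q: "poly q w = (\<integral>\<omega>. (w - X \<omega>) ^ n \<partial>M)" for w
  proof -
    have "(w - X \<omega>) ^ n = (\<Sum>k\<le>n. (of_nat (n choose k) * (-1) ^ k * w ^ (n - k)) * X \<omega> ^ k)" for \<omega>
      using binomial_ring[of "- X \<omega>" w n]
      by (simp add: power_minus[of "X \<omega>"] mult_ac)
    then have "(\<integral>\<omega>. (w - X \<omega>) ^ n \<partial>M) =
        (\<Sum>k\<le>n. (of_nat (n choose k) * (-1) ^ k * w ^ (n - k)) * (\<integral>\<omega>. X \<omega> ^ k \<partial>M))"
      using assms by simp
    then show ?thesis
      by (simp add: q_def poly_sum poly_monom mult_ac)
  qed
  have "\<exists>!p. \<forall>w. poly p w = (\<integral>\<omega>. (w - X \<omega>) ^ n \<partial>M)"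
  proof (rule ex1I[of _ q])
    fix p assume "\<forall>w. poly p w = (\<integral>\<omega>. (w - X \<omega>) ^ n \<partial>M)"
    with q have "poly p = poly q" by auto
    then show "p = q" by (simp add: poly_eq_poly_eq_iff)
  qed (use q in blast)
  from theI'[OF this] show ?thesis
    unfolding expected_poly_def by blast
qed

text \<open>The normalized coefficient \<open>e\<^sub>k\<close> of \<open>p\<close>, for \<open>k \<le> n\<close> and \<open>degree p \<le> n\<close>.\<close>

definition norm_coeff :: "nat \<Rightarrow> complex poly \<Rightarrow> nat \<Rightarrow> complex" where
  "norm_coeff n p k = (-1) ^ k * coeff p (n - k) / of_nat (n choose k)"

lemma norm_coeff_iff:
  assumes "degree p \<le> n"
  shows "p = (\<Sum>k\<le>n. monom ((-1) ^ k * of_nat (n choose k) * e k) (n - k)) \<longleftrightarrow>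
         (\<forall>k\<le>n. e k = norm_coeff n p k)"
proof -
  let ?q = "\<Sum>k\<le>n. monom ((-1) ^ k * of_nat (n choose k) * e k) (n - k)"
  have c: "coeff ?q (n - k) = (-1) ^ k * of_nat (n choose k) * e k" if "k \<le> n" for k
  proof -
    have "coeff ?q (n - k) =
        (\<Sum>l\<le>n. if l = k then (-1) ^ l * of_nat (n choose l) * e l else 0)"
      unfolding coeff_sum coeff_monom using that by (intro sum.cong) auto
    then show ?thesis using that by simp
  qed
  have dq: "degree ?q \<le> n"
    by (intro degree_sum_le order.trans[OF degree_monom_le]) auto
  have "p = ?q \<longleftrightarrow> (\<forall>k\<le>n. coeff p (n - k) = coeff ?q (n - k))"
  proof
    assume r: "\<forall>k\<le>n. coeff p (n - k) = coeff ?q (n - k)"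
    show "p = ?q"
    proof (rule poly_eqI)
      fix m show "coeff p m = coeff ?q m"
      proof (cases "m \<le> n")
        case True
        with r[rule_format, of "n - m"] show ?thesis by simp
      next
        case False
        with assms dq show ?thesis by (simp add: coeff_eq_0)
      qed
    qed
  qed simp
  also have "\<dots> \<longleftrightarrow> (\<forall>k\<le>n. e k = norm_coeff n p k)"
  proof -
    have "coeff p (n - k) = (-1) ^ k * of_nat (n choose k) * e k \<longleftrightarrow> e k = norm_coeff n p k"
      if "k \<le> n" for k
      using that unfolding norm_coeff_def
      by (cases "even k") (auto simp: field_simps minus_equation_iff)
    then show ?thesis using c by auto
  qed
  finally show ?thesis .
qed

definition perpetuity_poly ::
    "nat \<Rightarrow> 'a measure \<Rightarrow> ('a \<Rightarrow> complex) \<Rightarrow> ('a \<Rightarrow> complex) \<Rightarrow> complex poly \<Rightarrow> bool" where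
  "perpetuity_poly n M A B p \<longleftrightarrow>
     (\<exists>X. finite_moments n M [X] \<and>
          eq_dist n M [X] M [\<lambda>\<omega>. A \<omega> * X \<omega> + B \<omega>] \<and>
          affinely_independent n M X A B \<and>
          p = expected_poly n M X)"

definition nonneg_real_rooted :: "complex poly \<Rightarrow> bool" where
  "nonneg_real_rooted p \<longleftrightarrow> (\<forall>z. poly p z = 0 \<longrightarrow> z \<in> \<real> \<and> 0 \<le> Re z)"

end

theory Submission
  imports Defs "HOL-Computational_Algebra.Fundamental_Theorem_Algebra"
begin

text \<open>The moments of a solution \<open>X\<close> are a fixed point of the linear map on moment sequences that
  sends the moments of \<open>X\<close> to those of \<open>A X + B\<close> for \<open>(A, B)\<close> independent of \<open>X\<close>. This map is
  triangular with diagonal \<open>E[A\<^sup>k]\<close>, so its iterates from the moments of \<open>0\<close> converge to the fixed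
  point. Admissibility factors it into multiplicative and additive finite free convolutions with the
  \<open>D i\<close>. These preserve nonnegative real-rootedness by Grace's theorem for half-planes bounded by a
  line through \<open>0\<close>: the convolution at \<open>z\<close> is an apolar pairing of a polynomial without roots in
  such a closed half-plane with one whose roots all lie in it. Finally, nonnegative real-rootedness
  of monic polynomials is a closed condition.\<close>

subsection \<open>Grace's theorem for half-planes\<close>

text \<open>Laguerre's polar derivative with pole \<open>d\<close>. Here \<open>n\<close> is a
  formal degree, which may exceed the actual degree of \<open>f\<close>.\<close>

definition polar :: "nat \<Rightarrow> complex \<Rightarrow> complex poly \<Rightarrow> complex poly" where
  "polar n d f = smult (of_nat n) f - [:- d, 1:] * pderiv f"

lemma degree_polar:
  assumes "degree f \<le> Suc n"
  shows "degree (polar (Suc n) d f) \<le> n"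
proof (rule degree_le, intro allI impI)
  fix i assume "n < i"
  then obtain j where i: "i = Suc j" "n \<le> j" by (cases i) auto
  have z: "coeff f k = 0" if "Suc n < k" for k
    using assms that by (simp add: coeff_eq_0)
  \<comment> \<open>For \<open>j = n\<close> both summands contribute \<open>Suc n\<close> times the
    coefficient of \<open>f\<close> at \<open>Suc n\<close> and cancel; for larger \<open>j\<close>
    every coefficient involved is zero.\<close>
  show "coeff (polar (Suc n) d f) i = 0"
    using i z[of "Suc j"] z[of "Suc (Suc j)"]
    by (cases "j = n") (auto simp: polar_def coeff_pderiv coeff_pCons algebra_simps)
qed

lemma polar_add: "polar n d (f + g) = polar n d f + polar n d g"
  by (simp add: polar_def pderiv_add smult_add_right algebra_simps)

lemma polar_smult: "polar n d (smult a f) = smult a (polar n d f)"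
  by (simp add: polar_def pderiv_smult smult_diff_right mult.commute)

text \<open>The polynomial \<open>[:z, - 1:]\<close> is z - x, and (z - x) + (x - d) = z - d. This
  makes iterated polar derivatives computable on powers of z - x.\<close>

lemma polar_power:
  "polar (Suc n) d ([:z, - 1:] ^ Suc n) = smult (of_nat (Suc n) * (z - d)) ([:z, - 1:] ^ n)"
proof -
  have "pderiv ([:z, - 1:] ^ Suc n) = smult (- of_nat (Suc n)) ([:z, - 1:] ^ n)"
    by (simp only: pderiv_power_Suc) (simp add: pderiv_pCons)
  then have "polar (Suc n) d ([:z, - 1:] ^ Suc n) =
      smult (of_nat (Suc n)) (([:z, - 1:] + [:- d, 1:]) * [:z, - 1:] ^ n)"
    unfolding polar_def power_Suc distrib_right smult_add_right
    by (simp only: mult_smult_right smult_minus_left mult_minus_right diff_minus_eq_add)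
  then show ?thesis by simp
qed

text \<open>The logarithmic derivative of a product of linear factors, with the denominator
  cleared.\<close>

lemma pderiv_prod_list_linear:
  fixes x :: complex
  assumes "poly (\<Prod>r\<leftarrow>rs. [:- r, 1:]) x \<noteq> 0"
  shows "poly (pderiv (\<Prod>r\<leftarrow>rs. [:- r, 1:])) x =
         poly (\<Prod>r\<leftarrow>rs. [:- r, 1:]) x * (\<Sum>r\<leftarrow>rs. 1 / (x - r))"
  using assms
proof (induction rs)
  case (Cons r rs)
  then have "x - r \<noteq> 0" by simp
  with Cons show ?case
    by (simp add: pderiv_mult pderiv_pCons field_simps del: mult_pCons_left)
qed simp

lemma complex_poly_decompose_list:
  obtains rs :: "complex list" where
    "p = smult (lead_coeff p) (\<Prod>r\<leftarrow>rs. [:- r, 1:])" "length rs = degree p"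
proof -
  obtain rs where rs: "mset rs = proots p" using ex_mset by blast
  then have "length rs = degree p" by (metis size_mset size_proots_complex)
  with complex_poly_decompose_multiset[of p] show ?thesis
    by (intro that[of rs]) (auto simp: prod_mset_prod_list simp flip: rs mset_map)
qed

text \<open>Triangle inequality, then Cauchy-Schwarz against the all-ones vector. In the next proof
  it serves as Jensen's inequality for the quadratic part of \<open>g\<close>.\<close>

lemma cmod_sum_list_square:
  "(cmod (\<Sum>u\<leftarrow>us. u))\<^sup>2 \<le> real (length us) * (\<Sum>u\<leftarrow>us. (cmod u)\<^sup>2)"
proof -
  let ?s = "\<Sum>i<length us. cmod (us ! i)"
  have "cmod (\<Sum>u\<leftarrow>us. u) \<le> ?s"
    by (simp add: sum_list_sum_nth atLeast0LessThan norm_sum)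
  then have "(cmod (\<Sum>u\<leftarrow>us. u))\<^sup>2 \<le> ?s\<^sup>2"
    by (intro power_mono) auto
  also have "?s\<^sup>2 \<le> (\<Sum>i<length us. 1\<^sup>2) * (\<Sum>i<length us. (cmod (us ! i))\<^sup>2)"
    using Cauchy_Schwarz_ineq_sum[of "\<lambda>_. 1" "\<lambda>i. cmod (us ! i)" "{..<length us}"] by simp
  finally show ?thesis by (simp add: sum_list_sum_nth atLeast0LessThan)
qed

text \<open>Seen through \<open>w \<mapsto> 1 / (x - w)\<close>, the complement of the half-plane becomes the set where the
  concave function \<open>g u = Re (c * cnj u) - Re (c * x) * (cmod u)\<^sup>2\<close> is positive. A polar root \<open>x\<close> would
  exhibit \<open>1 / (x - d)\<close>, where \<open>g\<close> is nonpositive, as a mean of points where \<open>g\<close> is positive and of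
  copies of \<open>0\<close>, where \<open>g\<close> vanishes.\<close>

lemma polar_nonzero_halfplane:
  fixes c :: complex
  assumes deg: "degree f \<le> n" "0 < n"
    and f: "\<And>w. Re (c * w) \<ge> 0 \<Longrightarrow> poly f w \<noteq> 0"
    and d: "Re (c * d) \<ge> 0" and x: "Re (c * x) \<ge> 0"
  shows "poly (polar n d f) x \<noteq> 0"
proof
  assume polar0: "poly (polar n d f) x = 0"
  obtain rs where rs: "f = smult (lead_coeff f) (\<Prod>r\<leftarrow>rs. [:- r, 1:])" "length rs = degree f"
    by (rule complex_poly_decompose_list)
  define q where "q = (\<Prod>r\<leftarrow>rs. [:- r, 1:])"
  obtain a where fq: "f = smult a q" using rs(1) unfolding q_def by blast
  have fx: "poly f x \<noteq> 0" using f x by blast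
  have qx: "poly q x \<noteq> 0" using fx fq by simp
  define us where "us = map (\<lambda>r. 1 / (x - r)) rs"
  have "poly (pderiv f) x = poly f x * (\<Sum>u\<leftarrow>us. u)"
    using pderiv_prod_list_linear[of rs x] qx fq unfolding q_def us_def
    by (simp add: pderiv_smult)
  with polar0 have "poly f x * (of_nat n - (x - d) * (\<Sum>u\<leftarrow>us. u)) = 0"
    by (simp add: polar_def algebra_simps)
  \<comment> \<open>Cancelling \<open>poly f x\<close> leaves an equation for the logarithmic
    derivative: the entries of \<open>us\<close> sum to n / (x - d).\<close>
  with fx have eq: "of_nat n = (x - d) * (\<Sum>u\<leftarrow>us. u)" by simp
  define v where "v = 1 / (x - d)"
  have xd: "x - d \<noteq> 0" using eq deg(2) by auto
  have sum: "(\<Sum>u\<leftarrow>us. u) = of_nat n * v" using eq xd by (simp add: v_def field_simps)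
  define t where "t = Re (c * x)"
  define g where "g = (\<lambda>u. Re (c * cnj u) - t * (cmod u)\<^sup>2)"
  \<comment> \<open>For y = x - w the numerator is - Re (c * w), so \<open>g\<close> is positive at
    1 / (x - w) exactly when w lies outside the closed half-plane.\<close>
  have g_inv: "g (1 / y) = (Re (c * y) - t) / (cmod y)\<^sup>2" if "y \<noteq> 0" for y
  proof -
    have "c * cnj (1 / y) = c * y / of_real ((cmod y)\<^sup>2)"
      using that complex_norm_square[of y] by (simp add: field_simps)
    then have Re_eq: "Re (c * cnj (1 / y)) = Re (c * y) / (cmod y)\<^sup>2"
      by (simp only: Re_divide_of_real)
    show ?thesis
      unfolding g_def Re_eq by (simp add: norm_divide power_divide diff_divide_distrib)
  qed
  have "g v \<le> 0"
    using g_inv[OF xd] d by (simp add: v_def t_def algebra_simps divide_nonpos_nonneg)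
  have pos: "g u > 0" if "u \<in> set us" for u
  proof -
    obtain r where r: "r \<in> set rs" "u = 1 / (x - r)" using \<open>u \<in> set us\<close> by (auto simp: us_def)
    have "poly q r = 0" using r(1) unfolding q_def by (induction rs) auto
    then have "poly f r = 0" using fq by simp
    then have "Re (c * r) < 0" using f not_less by blast
    moreover have "x \<noteq> r" using fx \<open>poly f r = 0\<close> by auto
    ultimately show ?thesis using g_inv[of "x - r"] r(2)
      by (simp add: t_def algebra_simps)
  qed
  have "us \<noteq> []" using sum xd deg(2) by (auto simp: v_def)
  have "0 < (\<Sum>u\<leftarrow>us. g u)"
    using \<open>us \<noteq> []\<close> pos by (induction us rule: list_nonempty_induct) (auto simp: add_pos_pos)
  also have "\<dots> = Re (c * cnj (\<Sum>u\<leftarrow>us. u)) - t * (\<Sum>u\<leftarrow>us. (cmod u)\<^sup>2)"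
    by (induction us) (auto simp: g_def algebra_simps)
  finally have "real n * (t * (\<Sum>u\<leftarrow>us. (cmod u)\<^sup>2)) < real n * Re (c * cnj (\<Sum>u\<leftarrow>us. u))"
    using deg(2) by simp
  \<comment> \<open>Concavity of \<open>g\<close> enters through \<open>0 \<le> t\<close>. Replacing
    \<open>length us\<close> by \<open>n\<close> amounts to padding the mean with zeros when
    \<open>degree f < n\<close>.\<close>
  moreover have "t * (cmod (\<Sum>u\<leftarrow>us. u))\<^sup>2 \<le> t * (real n * (\<Sum>u\<leftarrow>us. (cmod u)\<^sup>2))"
  proof (intro mult_left_mono order.trans[OF cmod_sum_list_square] mult_right_mono)
    show "real (length us) \<le> real n" using rs(2) deg(1) by (simp add: us_def)
    show "0 \<le> (\<Sum>u\<leftarrow>us. (cmod u)\<^sup>2)" by (induction us) auto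
    show "0 \<le> t" using x by (simp add: t_def)
  qed
  ultimately have "0 < real n * Re (c * cnj (\<Sum>u\<leftarrow>us. u)) - t * (cmod (\<Sum>u\<leftarrow>us. u))\<^sup>2"
    by (simp add: mult.left_commute)
  also have "\<dots> = (real n)\<^sup>2 * g v"
    unfolding sum by (simp add: g_def norm_mult power_mult_distrib algebra_simps power2_eq_square)
  finally show False using \<open>g v \<le> 0\<close> by (simp add: zero_less_mult_iff)
qed

text \<open>The formal degree drops by one with each pole, so a constant remains if
  \<open>degree f \<le> length ds\<close>. Up to a factorial it is the apolar pairing of
  \<open>f\<close> with the monic polynomial with root list \<open>ds\<close>.\<close>

primrec apolar :: "complex list \<Rightarrow> complex poly \<Rightarrow> complex poly" where
  "apolar [] f = f"
| "apolar (d # ds) f = apolar ds (polar (Suc (length ds)) d f)"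

lemma apolar_add: "apolar ds (f + g) = apolar ds f + apolar ds g"
  by (induction ds arbitrary: f g) (simp_all add: polar_add)

lemma apolar_smult: "apolar ds (smult a f) = smult a (apolar ds f)"
  by (induction ds arbitrary: f) (simp_all add: polar_smult)

lemma apolar_sum: "apolar ds (\<Sum>k\<in>K. f k) = (\<Sum>k\<in>K. apolar ds (f k))"
proof (cases "finite K")
  case True
  then show ?thesis
    by (induction K rule: finite_induct) (use apolar_smult[of ds 0 0] in \<open>simp_all add: apolar_add\<close>)
next
  case False
  then show ?thesis using apolar_smult[of ds 0 0] by simp
qed

text \<open>Each pole \<open>d\<close> contributes a factor z - d and the current degree. As z
  varies, these powers span all polynomials of degree at most \<open>length ds\<close>, so the
  values determine the pairing.\<close>

lemma apolar_power:
  "apolar ds ([:z, - 1:] ^ length ds) = [:fact (length ds) * (\<Prod>d\<leftarrow>ds. z - d):]"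
  by (induction ds) (simp_all add: polar_power apolar_smult algebra_simps del: power_Suc)

text \<open>Induction over the poles: each polar derivative stays free of roots in the closed
  half-plane while the degree bound drops by one.\<close>

lemma apolar_nonzero_halfplane:
  fixes c :: complex
  assumes "degree f \<le> length ds"
    and "\<And>w. Re (c * w) \<ge> 0 \<Longrightarrow> poly f w \<noteq> 0"
    and "\<And>d. d \<in> set ds \<Longrightarrow> Re (c * d) \<ge> 0"
    and "Re (c * x) \<ge> 0"
  shows "poly (apolar ds f) x \<noteq> 0"
  using assms
proof (induction ds arbitrary: f)
  case (Cons d ds)
  show ?case unfolding apolar.simps
  proof (rule Cons.IH)
    show "degree (polar (Suc (length ds)) d f) \<le> length ds"
      using Cons.prems(1) by (intro degree_polar) simp
    show "poly (polar (Suc (length ds)) d f) w \<noteq> 0" if "Re (c * w) \<ge> 0" for w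
      using Cons.prems that by (intro polar_nonzero_halfplane[of f _ c]) auto
  qed (use Cons.prems in auto)
qed auto

section \<open>Moment polynomials and Grace's theorem in terms of coefficients\<close>

definition moment_poly :: "nat \<Rightarrow> (nat \<Rightarrow> complex) \<Rightarrow> complex poly" where
  "moment_poly n m = (\<Sum>k\<le>n. monom ((-1) ^ k * of_nat (n choose k) * m k) (n - k))"

lemma degree_moment_poly_le: "degree (moment_poly n m) \<le> n"
  unfolding moment_poly_def by (intro degree_sum_le order.trans[OF degree_monom_le]) auto

lemma norm_coeff_moment_poly: "k \<le> n \<Longrightarrow> norm_coeff n (moment_poly n m) k = m k"
  using norm_coeff_iff[OF degree_moment_poly_le, of n m m] by (simp add: moment_poly_def)

lemma poly_moment_poly:
  "poly (moment_poly n m) z = (\<Sum>k\<le>n. (-1) ^ k * of_nat (n choose k) * m k * z ^ (n - k))"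
  by (simp add: moment_poly_def poly_sum poly_monom)

lemma moment_poly_monic:
  assumes "m 0 = 1"
  obtains rs where "moment_poly n m = (\<Prod>r\<leftarrow>rs. [:- r, 1:])" "length rs = n"
proof -
  have "coeff (moment_poly n m) n = 1"
    using norm_coeff_moment_poly[of 0 n m] assms by (simp add: norm_coeff_def)
  moreover from this have "degree (moment_poly n m) = n"
    using degree_moment_poly_le[of n m] le_degree[of "moment_poly n m" n] by simp
  ultimately show ?thesis
    using complex_poly_decompose_list[of "moment_poly n m"] that by (metis smult_1_left)
qed

lemma power_linear_expand:
  "[:z, - 1:] ^ n = (\<Sum>k\<le>n. smult ((-1) ^ k * of_nat (n choose k) * z ^ (n - k)) (monom (1::complex) k))"
proof -
  have "[:z, - 1:] ^ n = (monom (-1) 1 + monom z 0) ^ n"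
    by (simp add: monom_altdef)
  also have "\<dots> = (\<Sum>k\<le>n. smult ((-1) ^ k * of_nat (n choose k) * z ^ (n - k)) (monom (1::complex) k))"
    unfolding binomial_ring
    by (intro sum.cong refl)
      (simp add: monom_power mult_monom smult_monom of_nat_monom mult_ac)
  finally show ?thesis .
qed

text \<open>The sum is the normalized apolar pairing of \<open>f\<close> with the roots of
  \<open>moment_poly n m\<close>: both are linear in \<open>f\<close>, and comparing coefficients in
  z on the powers of z - x shows that they agree on monomials.\<close>

lemma grace_halfplane:
  fixes c :: complex
  assumes m0: "m 0 = 1" and deg: "degree f \<le> n"
    and f: "\<And>w. Re (c * w) \<ge> 0 \<Longrightarrow> poly f w \<noteq> 0"
    and m: "\<And>w. poly (moment_poly n m) w = 0 \<Longrightarrow> Re (c * w) \<ge> 0"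
  shows "(\<Sum>k\<le>n. coeff f k * m k) \<noteq> 0"
proof -
  obtain ds where ds: "moment_poly n m = (\<Prod>d\<leftarrow>ds. [:- d, 1:])" "length ds = n"
    using moment_poly_monic[of m n] m0 by blast
  \<comment> \<open>Evaluation at 0 is harmless, as the pairing is constant in degree at most
    \<open>n\<close>, and 0 lies in every half-plane considered.\<close>
  define \<Lambda> where "\<Lambda> = (\<lambda>f. poly (apolar ds f) 0 / fact n)"
  have \<Lambda>_sum: "\<Lambda> (\<Sum>k\<le>n. smult (a k) (h k)) = (\<Sum>k\<le>n. a k * \<Lambda> (h k))" for a h
    by (simp add: \<Lambda>_def apolar_sum apolar_smult poly_sum sum_divide_distrib)
  define \<mu> where "\<mu> k = \<Lambda> (monom 1 k)" for k
  have "poly (moment_poly n m) z = poly (moment_poly n \<mu>) z" for z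
  proof -
    have "poly (moment_poly n m) z = (\<Prod>d\<leftarrow>ds. z - d)"
      unfolding ds(1) by (induction ds) (auto simp: algebra_simps)
    also have "\<dots> = \<Lambda> ([:z, - 1:] ^ n)"
      using apolar_power[of ds z] ds(2) by (simp add: \<Lambda>_def)
    also have "\<dots> = poly (moment_poly n \<mu>) z"
      unfolding power_linear_expand \<Lambda>_sum poly_moment_poly by (simp add: \<mu>_def mult_ac)
    finally show ?thesis .
  qed
  then have "moment_poly n m = moment_poly n \<mu>"
    by (simp add: poly_eq_poly_eq_iff[symmetric] fun_eq_iff)
  then have m\<mu>: "m k = \<mu> k" if "k \<le> n" for k
    using norm_coeff_moment_poly[OF that, of m] norm_coeff_moment_poly[OF that, of \<mu>] by simp
  have "f = (\<Sum>k\<le>n. smult (coeff f k) (monom 1 k))"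
    using poly_as_sum_of_monoms'[OF deg] by (simp add: smult_monom)
  then have "\<Lambda> f = (\<Sum>k\<le>n. coeff f k * m k)"
    using \<Lambda>_sum[of "coeff f" "monom 1"] m\<mu> by (simp add: \<mu>_def)
  moreover have "poly (apolar ds f) 0 \<noteq> 0"
  proof (rule apolar_nonzero_halfplane[of f ds c])
    show "Re (c * d) \<ge> 0" if "d \<in> set ds" for d
    proof (rule m)
      show "poly (moment_poly n m) d = 0"
        using that unfolding ds(1) by (induction ds) auto
    qed
  qed (use deg f ds(2) in auto)
  ultimately show ?thesis by (auto simp: \<Lambda>_def)
qed

subsection \<open>Convolutions, limits and iteration\<close>

text \<open>A line through 0 separates \<open>z\<close> from the nonnegative axis;
  \<open>0 \<le> Re c\<close> says that the axis lies in the closed half-plane free of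
  \<open>z\<close>.\<close>

lemma off_nonneg_axis_halfplane:
  assumes "\<not> (z \<in> \<real> \<and> 0 \<le> Re z)"
  obtains c :: complex where "Re (c * z) < 0" "0 \<le> Re c"
proof -
  consider "Im z > 0" | "Im z < 0" | "Im z = 0" "Re z < 0"
    using assms by (fastforce simp: complex_is_Real_iff)
  then show ?thesis
    by cases (use that[of \<i>] that[of "- \<i>"] that[of 1] in auto)
qed

lemma Re_mult_nonneg_axis: "z \<in> \<real> \<Longrightarrow> 0 \<le> Re z \<Longrightarrow> 0 \<le> Re c \<Longrightarrow> 0 \<le> Re (c * z)"
  by (simp add: complex_is_Real_iff)

text \<open>Two groupings of one trinomial sum over s = j + i + t, with r = j + i. \<open>H\<close>
  is arbitrary because the identity is applied both to the pairing with Grace's theorem and to mixed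
  moments.\<close>

lemma binomial_convolution_assoc:
  "(\<Sum>j\<le>s. of_nat (s choose j) * (\<Sum>i\<le>s - j. of_nat ((s - j) choose i) * H j i (s - j - i))) =
   (\<Sum>r\<le>s. of_nat (s choose r) * (\<Sum>j\<le>r. of_nat (r choose j) * (H j (r - j) (s - r) :: 'a :: comm_semiring_1)))"
  unfolding sum_distrib_left sum.Sigma[OF finite_atMost ballI[OF finite_atMost]]
proof (rule sum.reindex_bij_witness[of _ "\<lambda>(r, j). (j, r - j)" "\<lambda>(j, i). (j + i, j)"])
  fix p assume "p \<in> (SIGMA j:{..s}. {..s - j})"
  then obtain j i where p: "p = (j, i)" "j \<le> s" "i \<le> s - j" by auto
  then have "(s choose (j + i)) * ((j + i) choose j) = (s choose j) * ((s - j) choose i)"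
    using choose_mult[of j "j + i" s] by simp
  then have "(of_nat (s choose (j + i)) * of_nat ((j + i) choose j) :: 'a) =
      of_nat (s choose j) * of_nat ((s - j) choose i)"
    by (metis of_nat_mult)
  then show "(case case p of (j, i) \<Rightarrow> (j + i, j) of
        (r, j) \<Rightarrow> of_nat (s choose r) * (of_nat (r choose j) * H j (r - j) (s - r))) =
      (case p of (j, i) \<Rightarrow> of_nat (s choose j) * (of_nat ((s - j) choose i) * H j i (s - j - i)))"
    using p by (simp flip: mult.assoc)
qed auto

text \<open>Multiplicative convolution. Its value at \<open>z\<close> is the pairing of
  \<open>d\<close> with \<open>f\<close>, which is x ^ n times the moment polynomial of
  \<open>m\<close> at z / x. A root w of \<open>f\<close> would make \<open>z\<close> a nonnegative
  multiple of w, hence keep \<open>z\<close> in the half-plane of w.\<close>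

lemma nonneg_real_rooted_mult:
  assumes m0: "m 0 = 1" and d0: "d 0 = 1"
    and m: "nonneg_real_rooted (moment_poly n m)" and d: "nonneg_real_rooted (moment_poly n d)"
  shows "nonneg_real_rooted (moment_poly n (\<lambda>k. m k * d k))"
  unfolding nonneg_real_rooted_def
proof (intro allI impI, rule ccontr)
  fix z assume z0: "poly (moment_poly n (\<lambda>k. m k * d k)) z = 0" and "\<not> (z \<in> \<real> \<and> 0 \<le> Re z)"
  then obtain c where c: "Re (c * z) < 0" "0 \<le> Re c"
    by (metis off_nonneg_axis_halfplane)
  then have "z \<noteq> 0" by auto
  define f where "f = (\<Sum>k\<le>n. monom ((-1) ^ k * of_nat (n choose k) * m k * z ^ (n - k)) k)"
  have f: "poly f x = x ^ n * poly (moment_poly n m) (z / x)" if "x \<noteq> 0" for x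
    unfolding f_def poly_moment_poly poly_sum poly_monom sum_distrib_left
  proof (intro sum.cong refl)
    fix k assume "k \<in> {..n}"
    then have "x ^ n = x ^ k * x ^ (n - k)" by (simp flip: power_add)
    then show "(-1) ^ k * of_nat (n choose k) * m k * z ^ (n - k) * x ^ k =
        x ^ n * ((-1) ^ k * of_nat (n choose k) * m k * (z / x) ^ (n - k))"
      using that by (simp add: power_divide)
  qed
  have coeff_f: "coeff f k = (-1) ^ k * of_nat (n choose k) * m k * z ^ (n - k)" if "k \<le> n" for k
    using that by (simp add: f_def coeff_sum)
  have "(\<Sum>k\<le>n. coeff f k * d k) \<noteq> 0"
  proof (rule grace_halfplane[of d f n c])
    show "degree f \<le> n"
      unfolding f_def by (intro degree_sum_le order.trans[OF degree_monom_le]) auto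
    show "poly f w \<noteq> 0" if w: "0 \<le> Re (c * w)" for w
    proof (cases "w = 0")
      \<comment> \<open>The formula \<open>f\<close> with z / x does not cover 0; there the constant
        coefficient z ^ n decides.\<close>
      case True
      then show ?thesis using coeff_f[of 0] m0 \<open>z \<noteq> 0\<close> by (simp add: poly_0_coeff_0)
    next
      case False
      have "poly (moment_poly n m) (z / w) \<noteq> 0"
      proof
        assume "poly (moment_poly n m) (z / w) = 0"
        then have zw: "z / w \<in> \<real>" "0 \<le> Re (z / w)"
          using m unfolding nonneg_real_rooted_def by blast+
        have "z = of_real (Re (z / w)) * w"
          using zw False by (simp add: of_real_Re)
        then have "c * z = of_real (Re (z / w)) * (c * w)" by (metis mult.left_commute)
        moreover have "Re (of_real r * u) = r * Re u" for r u by simp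
        ultimately have "Re (c * z) = Re (z / w) * Re (c * w)" by metis
        then show False using zw w c(1) by (metis mult_nonneg_nonneg not_less)
      qed
      then show ?thesis using f False by simp
    qed
    show "0 \<le> Re (c * w)" if "poly (moment_poly n d) w = 0" for w
      using that d c(2) unfolding nonneg_real_rooted_def by (blast intro: Re_mult_nonneg_axis)
  qed fact
  moreover have "(\<Sum>k\<le>n. coeff f k * d k) = poly (moment_poly n (\<lambda>k. m k * d k)) z"
    unfolding poly_moment_poly by (intro sum.cong refl) (simp add: coeff_f)
  ultimately show False using z0 by simp
qed

text \<open>The moments of a sum of independent variables; on moment polynomials this is the finite
  free additive convolution.\<close>

definition binomial_convolution :: "(nat \<Rightarrow> complex) \<Rightarrow> (nat \<Rightarrow> complex) \<Rightarrow> nat \<Rightarrow> complex" where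
  "binomial_convolution m d s = (\<Sum>r\<le>s. of_nat (s choose r) * (m r * d (s - r)))"

text \<open>As in the multiplicative case, but with \<open>f\<close> equal to the moment polynomial
  of \<open>m\<close> at z - x. A root w of \<open>f\<close> in the half-plane would put z - w on
  the nonnegative axis, and then \<open>z\<close> in the half-plane too.\<close>

lemma nonneg_real_rooted_binomial_convolution:
  assumes m0: "m 0 = 1" and d0: "d 0 = 1"
    and m: "nonneg_real_rooted (moment_poly n m)" and d: "nonneg_real_rooted (moment_poly n d)"
  shows "nonneg_real_rooted (moment_poly n (binomial_convolution m d))"
  unfolding nonneg_real_rooted_def
proof (intro allI impI, rule ccontr)
  fix z assume z0: "poly (moment_poly n (binomial_convolution m d)) z = 0" and "\<not> (z \<in> \<real> \<and> 0 \<le> Re z)"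
  then obtain c where c: "Re (c * z) < 0" "0 \<le> Re c"
    by (metis off_nonneg_axis_halfplane)
  define f where "f = (\<Sum>k\<le>n. smult ((-1) ^ k * of_nat (n choose k) * m k) ([:z, - 1:] ^ (n - k)))"
  have f: "poly f x = poly (moment_poly n m) (z - x)" for x
    by (simp add: f_def poly_moment_poly poly_sum)
  have deg: "degree f \<le> n"
    unfolding f_def
    by (intro degree_sum_le order.trans[OF degree_smult_le] order.trans[OF degree_power_le]) auto
  have pairing: "(\<Sum>l\<le>n. coeff f l * d l) =
      (\<Sum>k\<le>n. of_nat (n choose k) * (\<Sum>l\<le>n - k. of_nat ((n - k) choose l) *
         ((-1) ^ (k + l) * m k * d l * z ^ (n - k - l))))"
  proof -
    have co: "coeff ([:z, - 1:] ^ t) l = (if l \<le> t then (-1) ^ l * of_nat (t choose l) * z ^ (t - l) else 0)" for t l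
      unfolding power_linear_expand[of z t] coeff_sum
      by (simp add: smult_monom del: coeff_smult)
    have "(\<Sum>l\<le>n. coeff ([:z, - 1:] ^ (n - k)) l * d l) =
        (\<Sum>l\<le>n - k. (-1) ^ l * of_nat ((n - k) choose l) * z ^ (n - k - l) * d l)" for k
      by (intro sum.mono_neutral_cong_right) (auto simp: co)
    moreover have "(\<Sum>l\<le>n. coeff f l * d l) =
        (\<Sum>k\<le>n. (-1) ^ k * of_nat (n choose k) * m k * (\<Sum>l\<le>n. coeff ([:z, - 1:] ^ (n - k)) l * d l))"
      unfolding f_def coeff_sum sum_distrib_right sum_distrib_left
      by (subst sum.swap) (simp add: mult_ac)
    ultimately show ?thesis
      by (simp add: sum_distrib_left power_add mult_ac)
  qed
  \<comment> \<open>After regrouping by r = k + l the sign depends on r alone, and the inner sum is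
    the binomial convolution.\<close>
  have "(\<Sum>l\<le>n. coeff f l * d l) = poly (moment_poly n (binomial_convolution m d)) z"
    unfolding pairing poly_moment_poly binomial_convolution_def
      binomial_convolution_assoc[where H = "\<lambda>k l t. (-1) ^ (k + l) * m k * d l * z ^ t"]
    by (intro sum.cong refl) (simp add: sum_distrib_left mult_ac)
  moreover have "(\<Sum>k\<le>n. coeff f k * d k) \<noteq> 0"
  proof (rule grace_halfplane[of d f n c])
    show "poly f w \<noteq> 0" if w: "0 \<le> Re (c * w)" for w
    proof
      assume "poly f w = 0"
      then have "z - w \<in> \<real> \<and> 0 \<le> Re (z - w)"
        using m f unfolding nonneg_real_rooted_def by metis
      then have "0 \<le> Re (c * (z - w))" using Re_mult_nonneg_axis c(2) by blast
      then show False using w c(1) by (simp add: algebra_simps)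
    qed
    show "0 \<le> Re (c * w)" if "poly (moment_poly n d) w = 0" for w
      using that d c(2) unfolding nonneg_real_rooted_def by (blast intro: Re_mult_nonneg_axis)
  qed fact+
  ultimately show False using z0 by simp
qed

text \<open>A point at distance \<delta> from the closed nonnegative axis has distance at least
  \<delta> from each of the \<open>n\<close> roots. Monic polynomials with such roots are thus
  bounded below there by \<delta> ^ n, and so is the limit.\<close>

lemma nonneg_real_rooted_limit:
  assumes lim: "\<And>k. k \<le> n \<Longrightarrow> (\<lambda>t. m t k) \<longlonglongrightarrow> m' k"
    and m0: "\<And>t. m t 0 = 1" and m: "\<And>t. nonneg_real_rooted (moment_poly n (m t))"
  shows "nonneg_real_rooted (moment_poly n m')"
  unfolding nonneg_real_rooted_def
proof (intro allI impI, rule ccontr)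
  fix z assume z0: "poly (moment_poly n m') z = 0" and z: "\<not> (z \<in> \<real> \<and> 0 \<le> Re z)"
  let ?C = "{z. z \<in> \<real> \<and> 0 \<le> Re z}"
  have "closed ?C"
    unfolding Collect_conj_eq by (intro closed_Int closed_complex_Reals closed_halfspace_Re_ge)
      (simp add: closed_complex_Reals)
  then obtain \<delta> where \<delta>: "\<delta> > 0" "\<And>w. w \<in> ?C \<Longrightarrow> \<delta> \<le> dist z w"
    using z by (metis (mono_tags, lifting) mem_Collect_eq separate_point_closed)
  have low: "\<delta> ^ n \<le> cmod (poly (moment_poly n (m t)) z)" for t
  proof -
    obtain rs where rs: "moment_poly n (m t) = (\<Prod>r\<leftarrow>rs. [:- r, 1:])" "length rs = n"
      using moment_poly_monic[of "m t" n] m0 by blast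
    have "\<forall>r\<in>set rs. \<delta> \<le> cmod (z - r)"
    proof
      fix r assume "r \<in> set rs"
      then have "poly (moment_poly n (m t)) r = 0" unfolding rs(1) by (induction rs) auto
      then show "\<delta> \<le> cmod (z - r)"
        using m[of t] \<delta>(2)[of r] by (auto simp: nonneg_real_rooted_def dist_norm)
    qed
    then have "\<delta> ^ length rs \<le> cmod (poly (\<Prod>r\<leftarrow>rs. [:- r, 1:]) z)"
    proof (induction rs)
      case (Cons r rs)
      then have "\<delta> * \<delta> ^ length rs \<le> cmod (z - r) * cmod (poly (\<Prod>r\<leftarrow>rs. [:- r, 1:]) z)"
        using \<delta>(1) by (intro mult_mono) auto
      also have "\<dots> = cmod (poly (\<Prod>r\<leftarrow>r # rs. [:- r, 1:]) z)"
        by (simp add: algebra_simps flip: norm_mult)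
      finally show ?case by simp
    qed simp
    then show ?thesis using rs by simp
  qed
  have "(\<lambda>t. poly (moment_poly n (m t)) z) \<longlonglongrightarrow> poly (moment_poly n m') z"
    unfolding poly_moment_poly by (intro tendsto_intros lim) simp
  then have "(\<lambda>t. cmod (poly (moment_poly n (m t)) z)) \<longlonglongrightarrow> cmod (poly (moment_poly n m') z)"
    by (rule tendsto_norm)
  then have "\<delta> ^ n \<le> cmod (poly (moment_poly n m') z)"
    using low by (intro LIMSEQ_le_const) auto
  then show False using z0 zero_less_power[OF \<delta>(1), of n] by simp
qed

section \<open>Convergence of the iterated moment map\<close>

lemma geometric_decay_perturbed:
  fixes e \<epsilon> :: "nat \<Rightarrow> complex"
  assumes rec: "\<And>t. e (Suc t) = a * e t + \<epsilon> t" and a: "cmod a < \<rho>"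
    and \<epsilon>: "\<And>t. cmod (\<epsilon> t) \<le> S * \<rho> ^ t"
  shows "\<exists>K. \<forall>t. cmod (e t) \<le> K * \<rho> ^ t"
proof -
  \<comment> \<open>The first entry covers t = 0; the second gives |a| K + S \<le> \<rho> K, which
    carries the bound from t to t + 1.\<close>
  define K where "K = max (cmod (e 0)) (S / (\<rho> - cmod a))"
  have "S / (\<rho> - cmod a) \<le> K" by (simp add: K_def)
  then have K: "cmod a * K + S \<le> \<rho> * K"
    using a by (simp add: pos_divide_le_eq algebra_simps)
  have \<rho>: "0 \<le> \<rho>" using a norm_ge_zero[of a] by linarith
  have "cmod (e t) \<le> K * \<rho> ^ t" for t
  proof (induction t)
    case 0
    show ?case by (simp add: K_def)
  next
    case (Suc t)
    have "cmod (e (Suc t)) \<le> cmod a * cmod (e t) + cmod (\<epsilon> t)"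
      unfolding rec by (metis norm_mult norm_triangle_ineq)
    also have "\<dots> \<le> cmod a * (K * \<rho> ^ t) + S * \<rho> ^ t"
      by (intro add_mono mult_left_mono Suc.IH \<epsilon>) auto
    also have "\<dots> = (cmod a * K + S) * \<rho> ^ t" by (simp add: algebra_simps)
    also have "\<dots> \<le> (\<rho> * K) * \<rho> ^ t" using K \<rho> by (intro mult_right_mono) auto
    finally show ?case by (simp add: mult_ac)
  qed
  then show ?thesis by blast
qed

text \<open>If \<open>a j l\<close> is E[A^j B^l], these are the moments of A X + B for X
  independent of (A, B) with moments \<open>m\<close>.\<close>

definition affine_moments :: "(nat \<Rightarrow> nat \<Rightarrow> complex) \<Rightarrow> (nat \<Rightarrow> complex) \<Rightarrow> nat \<Rightarrow> complex" where
  "affine_moments a m s = (\<Sum>j\<le>s. of_nat (s choose j) * (a j (s - j) * m j))"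

text \<open>The error in moment \<open>k\<close> is multiplied by \<open>a k 0\<close> and perturbed
  by errors of lower moments only. Strong induction on \<open>k\<close> gives geometric decay with
  one common rate.\<close>

lemma affine_moments_iterates_tendsto:
  assumes fixp: "\<And>k. k \<le> n \<Longrightarrow> m k = affine_moments a m k"
    and \<mu>0: "\<And>t. \<mu> t 0 = m 0"
    and rec: "\<And>t. \<mu> (Suc t) = affine_moments a (\<mu> t)"
    and a: "\<And>k. k \<in> {1..n} \<Longrightarrow> cmod (a k 0) < 1"
    and k: "k \<le> n"
  shows "(\<lambda>t. \<mu> t k) \<longlonglongrightarrow> m k"
proof -
  define \<rho>0 where "\<rho>0 = Max (insert 0 ((\<lambda>k. cmod (a k 0)) ` {1..n}))"
  have "\<rho>0 < 1" unfolding \<rho>0_def using a by (subst Max_less_iff) auto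
  have "0 \<le> \<rho>0" unfolding \<rho>0_def by (intro Max_ge) auto
  \<comment> \<open>The rate must exceed every diagonal entry strictly, so that the perturbation of
    the same rate can be absorbed.\<close>
  obtain \<rho> where \<rho>: "\<rho>0 < \<rho>" "\<rho> < 1" using \<open>\<rho>0 < 1\<close> dense by blast
  have "\<exists>K. \<forall>t. cmod (\<mu> t k - m k) \<le> K * \<rho> ^ t" if "k \<le> n" for k
    using that
  proof (induction k rule: less_induct)
    case (less k)
    show ?case
    proof (cases "k = 0")
      case True
      then show ?thesis using \<mu>0 by (intro exI[of _ 0]) simp
    next
      case False
      have "\<forall>j\<in>{..<k}. \<exists>K. \<forall>t. cmod (\<mu> t j - m j) \<le> K * \<rho> ^ t"
        using less by auto
      then obtain K where K: "\<And>j t. j < k \<Longrightarrow> cmod (\<mu> t j - m j) \<le> K j * \<rho> ^ t"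
        unfolding bchoice_iff by auto
      define \<epsilon> where "\<epsilon> t = (\<Sum>j<k. of_nat (k choose j) * (a j (k - j) * (\<mu> t j - m j)))" for t
      show ?thesis
      proof (rule geometric_decay_perturbed)
        show "\<mu> (Suc t) k - m k = a k 0 * (\<mu> t k - m k) + \<epsilon> t" for t
        proof -
          have "\<mu> (Suc t) k - m k = affine_moments a (\<mu> t) k - affine_moments a m k"
            unfolding rec using fixp[OF less.prems] by metis
          also have "\<dots> = (\<Sum>j<Suc k. of_nat (k choose j) * (a j (k - j) * (\<mu> t j - m j)))"
            unfolding affine_moments_def lessThan_Suc_atMost
            by (simp add: right_diff_distrib sum_subtractf)
          finally show ?thesis unfolding \<epsilon>_def sum.lessThan_Suc by simp
        qed
        have "cmod (a k 0) \<le> \<rho>0"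
          unfolding \<rho>0_def using False less.prems by (intro Max_ge) auto
        then show "cmod (a k 0) < \<rho>" using \<rho> by simp
        show "cmod (\<epsilon> t) \<le> (\<Sum>j<k. real (k choose j) * (cmod (a j (k - j)) * K j)) * \<rho> ^ t" for t
          unfolding \<epsilon>_def sum_distrib_right
          by (intro sum_norm_le) (auto simp: norm_mult mult.assoc intro!: mult_left_mono K)
      qed
    qed
  qed
  then obtain K where K: "\<And>t. cmod (\<mu> t k - m k) \<le> K * \<rho> ^ t" using k by blast
  have "(\<lambda>t. K * \<rho> ^ t) \<longlonglongrightarrow> 0"
    using \<rho> \<open>0 \<le> \<rho>0\<close> by (intro tendsto_mult_right_zero LIMSEQ_power_zero) simp
  then have "(\<lambda>t. \<mu> t k - m k) \<longlonglongrightarrow> 0"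
    by (rule Lim_null_comparison[OF always_eventually[OF allI[OF K]]])
  then show ?thesis by (simp add: LIM_zero_iff)
qed

subsection \<open>Moments of affine compositions\<close>

lemma moment_poly_cong: "(\<And>k. k \<le> n \<Longrightarrow> m k = m' k) \<Longrightarrow> moment_poly n m = moment_poly n m'"
  unfolding moment_poly_def by (intro sum.cong) auto

lemma expected_poly_eq_moment_poly:
  assumes "\<And>k. k \<le> n \<Longrightarrow> integrable M (\<lambda>\<omega>. X \<omega> ^ k)"
  shows "expected_poly n M X = moment_poly n (\<lambda>k. \<integral>\<omega>. X \<omega> ^ k \<partial>M)"
proof -
  have "poly (expected_poly n M X) z = poly (moment_poly n (\<lambda>k. \<integral>\<omega>. X \<omega> ^ k \<partial>M)) z" for z
  proof -
    have "(z - X \<omega>) ^ n = (\<Sum>k\<le>n. ((-1) ^ k * of_nat (n choose k) * z ^ (n - k)) * X \<omega> ^ k)" for \<omega>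
      using binomial_ring[of "- X \<omega>" z n] by (simp add: power_minus[of "X \<omega>"] mult_ac)
    then show ?thesis
      using assms by (simp add: poly_expected_poly poly_moment_poly mult_ac)
  qed
  then show ?thesis by (simp add: poly_eq_poly_eq_iff[symmetric] fun_eq_iff)
qed

lemma (in finite_measure) integrable_power_le:
  fixes X :: "'a \<Rightarrow> complex"
  assumes "X \<in> borel_measurable M" "integrable M (\<lambda>\<omega>. cmod (X \<omega>) ^ n)" "k \<le> n"
  shows "integrable M (\<lambda>\<omega>. X \<omega> ^ k)"
proof (rule Bochner_Integration.integrable_bound[of _ "\<lambda>\<omega>. 1 + cmod (X \<omega>) ^ n"])
  have "x ^ k \<le> 1 + x ^ n" if "0 \<le> x" for x :: real
  proof (cases "x \<le> 1")
    case True
    then show ?thesis using that power_le_one[of x k] by (simp add: add_increasing2)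
  next
    case False
    then have "x ^ k \<le> x ^ n" using assms(3) by (intro power_increasing) auto
    then show ?thesis by simp
  qed
  then show "AE \<omega> in M. norm (X \<omega> ^ k) \<le> norm (1 + cmod (X \<omega>) ^ n)"
    by (simp add: norm_power)
qed (use assms in auto)

text \<open>The linear coefficient of the first \<open>k\<close> affine maps composed;
  \<open>affine_comp\<close> started at 0 is the constant term. Intersecting with
  \<open>{1..k}\<close> allows induction on \<open>k\<close> for fixed \<open>I\<close>.\<close>

definition affine_slope :: "nat set \<Rightarrow> nat \<Rightarrow> (nat \<Rightarrow> complex) \<Rightarrow> complex" where
  "affine_slope I k d = (\<Prod>i\<in>I \<inter> {1..k}. d i)"

lemma affine_slope_0: "affine_slope I 0 d = 1"
  by (simp add: affine_slope_def)

lemma affine_slope_Suc: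
  "affine_slope I (Suc k) d = (if Suc k \<in> I then d (Suc k) * affine_slope I k d else affine_slope I k d)"
  by (simp add: affine_slope_def atLeastAtMostSuc_conv)

lemma affine_comp_cong: "(\<And>i. i \<le> k \<Longrightarrow> d i = d' i) \<Longrightarrow> affine_comp I k d = affine_comp I k d'"
  by (induction k) auto

lemma affine_slope_cong: "(\<And>i. i \<in> {1..k} \<Longrightarrow> d i = d' i) \<Longrightarrow> affine_slope I k d = affine_slope I k d'"
  unfolding affine_slope_def by (intro prod.cong) auto

lemma measurable_affine_comp:
  assumes "k \<le> k'"
  shows "(\<lambda>d. affine_comp I k (d(0 := 0))) \<in> borel_measurable (PiM {1..k'} (\<lambda>_. borel))"
  using assms
proof (induction k)
  case (Suc k)
  have "(\<lambda>d. d (Suc k)) \<in> borel_measurable (PiM {1..k'} (\<lambda>_. borel :: complex measure))"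
    using Suc.prems by (intro measurable_component_singleton) simp
  with Suc show ?case by (cases "Suc k \<in> I") auto
qed simp

lemma measurable_affine_slope:
  "(\<lambda>d. affine_slope I k d) \<in> borel_measurable (PiM {1..k} (\<lambda>_. borel))"
  unfolding affine_slope_def by (intro borel_measurable_prod) simp

definition affine_monomial :: "nat set \<Rightarrow> nat \<Rightarrow> (nat \<Rightarrow> 'b \<Rightarrow> complex) \<Rightarrow> nat \<Rightarrow> nat \<Rightarrow> 'b \<Rightarrow> complex" where
  "affine_monomial I k D j l \<omega> =
     affine_slope I k (\<lambda>i. D i \<omega>) ^ j * affine_comp I k ((\<lambda>i. D i \<omega>)(0 := 0)) ^ l"

lemma affine_monomial_0_0: "affine_monomial I k D 0 0 = (\<lambda>_. 1)"
  by (simp add: affine_monomial_def fun_eq_iff)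

lemma affine_monomial_Suc_mult:
  "Suc k \<in> I \<Longrightarrow> affine_monomial I (Suc k) D j l \<omega> = affine_monomial I k D j l \<omega> * D (Suc k) \<omega> ^ (j + l)"
  by (simp add: affine_monomial_def affine_slope_Suc power_mult_distrib power_add mult_ac)

lemma affine_monomial_Suc_add:
  "Suc k \<notin> I \<Longrightarrow> affine_monomial I (Suc k) D j l \<omega> =
     (\<Sum>i\<le>l. of_nat (l choose i) * (affine_monomial I k D j i \<omega> * D (Suc k) \<omega> ^ (l - i)))"
  by (simp add: affine_monomial_def affine_slope_Suc binomial_ring sum_distrib_left mult_ac)

context prob_space
begin

text \<open>The two variables are measurable functions of the disjoint blocks \<open>{1..k}\<close>
  and \<open>{Suc k}\<close> of an independent family.\<close>

lemma indep_affine_monomial: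
  assumes ind: "indep_vars (\<lambda>_. borel) D {1..\<kappa>}" and k: "k < \<kappa>"
  shows "indep_var borel (affine_monomial I k D j l) borel (\<lambda>\<omega>. D (Suc k) \<omega> ^ r)"
proof -
  let ?R = "\<lambda>K \<omega>. restrict (\<lambda>i. D i \<omega>) K"
  let ?f = "\<lambda>d. affine_slope I k d ^ j * affine_comp I k (d(0 := 0)) ^ l"
  have "indep_var borel (?f \<circ> ?R {1..k}) borel ((\<lambda>d. d (Suc k) ^ r) \<circ> ?R {Suc k})"
  proof (rule indep_var_compose[OF indep_var_restrict[OF ind]])
    show "?f \<in> borel_measurable (PiM {1..k} (\<lambda>_. borel))"
      using measurable_affine_comp[of k k I] measurable_affine_slope[of I k] by measurable
  qed (use k in auto)
  moreover have "?f \<circ> ?R {1..k} = affine_monomial I k D j l"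
  proof
    fix \<omega>
    have "affine_slope I k (?R {1..k} \<omega>) = affine_slope I k (\<lambda>i. D i \<omega>)"
      by (intro affine_slope_cong) simp
    moreover have "affine_comp I k ((?R {1..k} \<omega>)(0 := 0)) = affine_comp I k ((\<lambda>i. D i \<omega>)(0 := 0))"
      by (intro affine_comp_cong) simp
    ultimately show "(?f \<circ> ?R {1..k}) \<omega> = affine_monomial I k D j l \<omega>"
      by (simp add: affine_monomial_def)
  qed
  moreover have "(\<lambda>d. d (Suc k) ^ r) \<circ> ?R {Suc k} = (\<lambda>\<omega>. D (Suc k) \<omega> ^ r)"
    by auto
  ultimately show ?thesis by simp
qed

lemma affine_composition_nonneg_real_rooted:
  assumes ind: "indep_vars (\<lambda>_. borel) D {1..\<kappa>}"
    and int: "\<And>i. i \<in> {1..\<kappa>} \<Longrightarrow> integrable M (\<lambda>\<omega>. cmod (D i \<omega>) ^ n)"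
    and D: "\<And>i. i \<in> {1..\<kappa>} \<Longrightarrow> nonneg_real_rooted (expected_poly n M (D i))"
    and m0: "m 0 = 1" and m: "nonneg_real_rooted (moment_poly n m)"
    and k: "k \<le> \<kappa>"
  shows "(\<forall>j l. j + l \<le> n \<longrightarrow> integrable M (affine_monomial I k D j l)) \<and>
    nonneg_real_rooted (moment_poly n (affine_moments (\<lambda>j l. expectation (affine_monomial I k D j l)) m))"
  using k
proof (induction k)
  case 0
  have zero: "affine_monomial I 0 D j l = (\<lambda>_. if l = 0 then 1 else 0)" for j l
    by (simp add: affine_monomial_def affine_slope_0 fun_eq_iff)
  then have "affine_moments (\<lambda>j l. expectation (affine_monomial I 0 D j l)) m s = m s" for s
    by (simp add: affine_moments_def prob_space if_distrib cong: if_cong)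
      (subst sum.mono_neutral_right[of _ "{s}"], auto)
  then have "affine_moments (\<lambda>j l. expectation (affine_monomial I 0 D j l)) m = m" by blast
  with m zero show ?case by simp
next
  case (Suc k)
  let ?D = "D (Suc k)"
  let ?a = "\<lambda>k j l. expectation (affine_monomial I k D j l)"
  define d where "d r = expectation (\<lambda>\<omega>. ?D \<omega> ^ r)" for r
  let ?m = "affine_moments (?a k) m"
  have IH: "\<And>j l. j + l \<le> n \<Longrightarrow> integrable M (affine_monomial I k D j l)"
    "nonneg_real_rooted (moment_poly n ?m)"
    using Suc by auto
  have "random_variable borel ?D"
    using ind Suc.prems by (auto simp: indep_vars_def)
  then have intD: "integrable M (\<lambda>\<omega>. ?D \<omega> ^ r)" if "r \<le> n" for r
    using that int Suc.prems by (intro integrable_power_le[of _ n]) auto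
  have dn: "nonneg_real_rooted (moment_poly n d)"
    using D[of "Suc k"] Suc.prems expected_poly_eq_moment_poly[of n M ?D] intD
    by (simp add: d_def[abs_def])
  have d0: "d 0 = 1" by (simp add: d_def prob_space)
  have mk0: "?m 0 = 1"
    using m0 by (simp add: affine_moments_def affine_monomial_0_0 prob_space)
  note indep = indep_affine_monomial[OF ind, of k I] Suc.prems
  have int_prod: "integrable M (\<lambda>\<omega>. affine_monomial I k D j l \<omega> * ?D \<omega> ^ r)"
    if "j + l \<le> n" "r \<le> n" for j l r
    using indep by (intro indep_var_integrable IH intD that) auto
  have E_prod: "expectation (\<lambda>\<omega>. affine_monomial I k D j l \<omega> * ?D \<omega> ^ r) = ?a k j l * d r"
    if "j + l \<le> n" "r \<le> n" for j l r
    unfolding d_def using indep by (intro indep_var_lebesgue_integral IH intD that) auto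
  show ?case
  proof (cases "Suc k \<in> I")
    case True
    have eq: "affine_monomial I (Suc k) D j l = (\<lambda>\<omega>. affine_monomial I k D j l \<omega> * ?D \<omega> ^ (j + l))" for j l
      by (intro ext affine_monomial_Suc_mult True)
    have "moment_poly n (affine_moments (?a (Suc k)) m) = moment_poly n (\<lambda>s. ?m s * d s)"
    proof (rule moment_poly_cong)
      fix s assume "s \<le> n"
      then show "affine_moments (?a (Suc k)) m s = ?m s * d s"
        unfolding affine_moments_def sum_distrib_right
        by (intro sum.cong refl) (simp add: eq E_prod)
    qed
    moreover have "nonneg_real_rooted (moment_poly n (\<lambda>s. ?m s * d s))"
      by (intro nonneg_real_rooted_mult mk0 d0 IH dn)
    ultimately show ?thesis
      by (simp add: eq int_prod)
  next
    case False
    have eq: "affine_monomial I (Suc k) D j l =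
        (\<lambda>\<omega>. \<Sum>i\<le>l. of_nat (l choose i) * (affine_monomial I k D j i \<omega> * ?D \<omega> ^ (l - i)))" for j l
      by (intro ext affine_monomial_Suc_add False)
    have E: "?a (Suc k) j l = (\<Sum>i\<le>l. of_nat (l choose i) * (?a k j i * d (l - i)))" if "j + l \<le> n" for j l
    proof -
      have "?a (Suc k) j l =
          (\<Sum>i\<le>l. expectation (\<lambda>\<omega>. of_nat (l choose i) * (affine_monomial I k D j i \<omega> * ?D \<omega> ^ (l - i))))"
        unfolding eq using that
        by (intro Bochner_Integration.integral_sum integrable_mult_right int_prod) auto
      also have "\<dots> = (\<Sum>i\<le>l. of_nat (l choose i) * (?a k j i * d (l - i)))"
        using that by (intro sum.cong refl) (simp add: E_prod)
      finally show ?thesis .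
    qed
    have "moment_poly n (affine_moments (?a (Suc k)) m) = moment_poly n (binomial_convolution ?m d)"
    proof (rule moment_poly_cong)
      fix s assume "s \<le> n"
      then have "affine_moments (?a (Suc k)) m s =
          (\<Sum>j\<le>s. of_nat (s choose j) * (\<Sum>i\<le>s - j. of_nat ((s - j) choose i) * (?a k j i * d (s - j - i) * m j)))"
        unfolding affine_moments_def
        by (intro sum.cong refl) (simp add: E sum_distrib_left mult_ac)
      also have "\<dots> = binomial_convolution ?m d s"
        unfolding binomial_convolution_assoc[where H = "\<lambda>j i t. ?a k j i * d t * m j"]
          binomial_convolution_def affine_moments_def
        by (intro sum.cong refl) (simp add: sum_distrib_left mult_ac)
      finally show "affine_moments (?a (Suc k)) m s = binomial_convolution ?m d s" .
    qed
    moreover have "nonneg_real_rooted (moment_poly n (binomial_convolution ?m d))"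
      by (intro nonneg_real_rooted_binomial_convolution mk0 d0 IH dn)
    moreover have "integrable M (affine_monomial I (Suc k) D j l)" if "j + l \<le> n" for j l
      unfolding eq using that
      by (intro Bochner_Integration.integrable_sum integrable_mult_right int_prod) auto
    ultimately show ?thesis by simp
  qed
qed

end

lemma monomial_rv_pair: "monomial_rv [A, B] i \<omega> = A \<omega> ^ i 0 * B \<omega> ^ i 1"
  by (simp add: monomial_rv_def lessThan_Suc)

lemma perpetuity_moments:
  assumes eq: "eq_dist n M [X] M [\<lambda>\<omega>. A \<omega> * X \<omega> + B \<omega>]"
    and ind: "affinely_independent n M X A B" and k: "k \<le> n"
  shows "(\<integral>\<omega>. X \<omega> ^ k \<partial>M) =
    affine_moments (\<lambda>j l. \<integral>\<omega>. A \<omega> ^ j * B \<omega> ^ l \<partial>M) (\<lambda>k. \<integral>\<omega>. X \<omega> ^ k \<partial>M) k"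
proof -
  have ind': "integrable M (\<lambda>\<omega>. X \<omega> ^ j * A \<omega> ^ j * B \<omega> ^ (k - j))"
    "(\<integral>\<omega>. X \<omega> ^ j * A \<omega> ^ j * B \<omega> ^ (k - j) \<partial>M) =
       (\<integral>\<omega>. X \<omega> ^ j \<partial>M) * (\<integral>\<omega>. A \<omega> ^ j * B \<omega> ^ (k - j) \<partial>M)" if "j \<le> k" for j
    using ind that k unfolding affinely_independent_def by simp_all
  have "(\<integral>\<omega>. X \<omega> ^ k \<partial>M) = (\<integral>\<omega>. (A \<omega> * X \<omega> + B \<omega>) ^ k \<partial>M)"
    using eq k unfolding eq_dist_def monomial_rv_def
    by (auto dest!: conjunct2 spec[of _ "\<lambda>_. k"])
  also have "\<dots> = (\<integral>\<omega>. (\<Sum>j\<le>k. of_nat (k choose j) * (X \<omega> ^ j * A \<omega> ^ j * B \<omega> ^ (k - j))) \<partial>M)"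
    by (simp add: binomial_ring power_mult_distrib mult_ac)
  also have "\<dots> = (\<Sum>j\<le>k. of_nat (k choose j) * (\<integral>\<omega>. X \<omega> ^ j * A \<omega> ^ j * B \<omega> ^ (k - j) \<partial>M))"
    using ind'(1) by (subst Bochner_Integration.integral_sum) auto
  also have "\<dots> = affine_moments (\<lambda>j l. \<integral>\<omega>. A \<omega> ^ j * B \<omega> ^ l \<partial>M) (\<lambda>k. \<integral>\<omega>. X \<omega> ^ k \<partial>M) k"
    unfolding affine_moments_def by (intro sum.cong refl) (subst ind'(2), simp_all)
  finally show ?thesis .
qed

theorem theorem5p11:
  fixes n \<kappa> :: nat and I :: "nat set"
    and M :: "'a measure" and A B :: "'a \<Rightarrow> complex"
    and N :: "'b measure" and D :: "nat \<Rightarrow> 'b \<Rightarrow> complex"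
    and p :: "complex poly"
  assumes "n \<ge> 1"
    and "prob_space M" and "prob_space N"
    and "admissible_via n M A B \<kappa> I N D"
    and "\<And>i. i \<in> {1..\<kappa>} \<Longrightarrow> nonneg_real_rooted (expected_poly n N (D i))"
    and "\<And>m. m \<in> {1..n} \<Longrightarrow>
           cmod (\<integral>\<omega>. A \<omega> ^ m \<partial>M) = (\<Prod>i\<in>I. cmod (norm_coeff n (expected_poly n N (D i)) m)) \<and>
           (\<Prod>i\<in>I. cmod (norm_coeff n (expected_poly n N (D i)) m)) < 1"
    and "perpetuity_poly n M A B p"
  shows "nonneg_real_rooted p"
proof -
  interpret M: prob_space M by fact
  interpret N: prob_space N by fact
  obtain X where X: "finite_moments n M [X]" "eq_dist n M [X] M [\<lambda>\<omega>. A \<omega> * X \<omega> + B \<omega>]"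
    "affinely_independent n M X A B" "p = expected_poly n M X"
    using assms(7) unfolding perpetuity_poly_def by blast
  define m where "m k = (\<integral>\<omega>. X \<omega> ^ k \<partial>M)" for k
  define a where "a j l = N.expectation (affine_monomial I \<kappa> D j l)" for j l
  have I: "I \<subseteq> {1..\<kappa>}" and ind: "N.indep_vars (\<lambda>_. borel) D {1..\<kappa>}"
    and int: "\<And>i. i \<in> {1..\<kappa>} \<Longrightarrow> integrable N (\<lambda>\<omega>. cmod (D i \<omega>) ^ n)"
    and AB: "eq_dist n M [A, B] N
       [\<lambda>\<omega>. \<Prod>i\<in>I. D i \<omega>, \<lambda>\<omega>. affine_comp I \<kappa> ((\<lambda>i. D i \<omega>)(0 := 0))]"
    using assms(4) unfolding admissible_via_def by auto
  have "I \<inter> {1..\<kappa>} = I" using I by blast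
  then have monomial: "monomial_rv [\<lambda>\<omega>. \<Prod>i\<in>I. D i \<omega>, \<lambda>\<omega>. affine_comp I \<kappa> ((\<lambda>i. D i \<omega>)(0 := 0))] i =
      affine_monomial I \<kappa> D (i 0) (i 1)" for i
    by (simp add: fun_eq_iff monomial_rv_pair affine_monomial_def affine_slope_def)
  have a: "(\<integral>\<omega>. A \<omega> ^ j * B \<omega> ^ l \<partial>M) = a j l" if "j + l \<le> n" for j l
  proof -
    let ?i = "\<lambda>q. if q = 0 then j else l"
    have "(\<Sum>q<length [A, B]. ?i q) \<le> n" using that by (simp add: lessThan_Suc)
    then have "(\<integral>\<omega>. monomial_rv [A, B] ?i \<omega> \<partial>M) = a j l"
      using AB unfolding eq_dist_def monomial a_def by fastforce
    then show ?thesis by (simp add: monomial_rv_pair)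
  qed
  have "integrable M (\<lambda>\<omega>. X \<omega> ^ k)" if "k \<le> n" for k
  proof -
    have "integrable M (monomial_rv [X] (\<lambda>_. k))"
      using X(1) that unfolding finite_moments_def by simp
    then show ?thesis by (simp add: monomial_rv_def[abs_def])
  qed
  then have p: "p = moment_poly n m"
    unfolding X(4) m_def[abs_def] by (rule expected_poly_eq_moment_poly)
  have fixed: "m k = affine_moments a m k" if "k \<le> n" for k
    using perpetuity_moments[OF X(2,3) that] that a
    by (simp add: m_def[abs_def] affine_moments_def)
  define \<mu> where "\<mu> t = (affine_moments a ^^ t) (\<lambda>k. if k = 0 then 1 else 0)" for t
  have \<mu>_Suc: "\<mu> (Suc t) = affine_moments a (\<mu> t)" for t
    by (simp add: \<mu>_def)
  have "a 0 0 = 1" by (simp add: a_def affine_monomial_0_0 N.prob_space)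
  then have \<mu>0: "\<mu> t 0 = 1" for t
    by (induction t) (simp add: \<mu>_def, simp add: \<mu>_Suc affine_moments_def)
  have "nonneg_real_rooted (moment_poly n (\<mu> t))" for t
  proof (induction t)
    case 0
    have "poly (moment_poly n (\<mu> 0)) z = z ^ n" for z
      unfolding poly_moment_poly by (subst sum.mono_neutral_right[of _ "{0}"]) (auto simp: \<mu>_def)
    then show ?case by (simp add: nonneg_real_rooted_def)
  next
    case (Suc t)
    then show ?case
      using N.affine_composition_nonneg_real_rooted
        [where n = n and m = "\<mu> t" and k = \<kappa> and I = I, OF ind int assms(5) \<mu>0]
      by (simp add: \<mu>_Suc a_def[abs_def])
  qed
  moreover have "(\<lambda>t. \<mu> t k) \<longlonglongrightarrow> m k" if "k \<le> n" for k
    using that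
  proof (rule affine_moments_iterates_tendsto[of n m a \<mu> k, rotated 4])
    show "\<mu> t 0 = m 0" for t by (simp add: \<mu>0 m_def M.prob_space)
    show "m k = affine_moments a m k" if "k \<le> n" for k using that by (rule fixed)
    show "\<mu> (Suc t) = affine_moments a (\<mu> t)" for t by (rule \<mu>_Suc)
    show "cmod (a k 0) < 1" if "k \<in> {1..n}" for k
      using assms(6)[OF that] a[of k 0] that by simp
  qed
  ultimately show ?thesis
    unfolding p using \<mu>0 by (intro nonneg_real_rooted_limit[of n \<mu> m])
qed

end
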